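(* Let $T>0$, $X\in C^2([0,T]^2;\mathbb{R}^d)$, $a\in\mathbb{R}^d$, and let $x^1,x^2:[0,T]\to\mathbb{R}^d$ be two $C^2$ paths. Set $\tau X_{t_1,t_2}:=X_{t_1,t_2}+x^1_{t_1}+x^2_{t_2}+a$. Then $\mathbf S(\tau X)=\mathbf S(X)$, i.e. for all words $w=(w_1,\dots,w_n)$ in $\{1,\dots,d\}$, all permutations $\nu$ of $\{1,\dots,n\}$ and all $\mathbf s=(s_1,s_2),\mathbf t=(t_1,t_2)\in[0,T]^2$ with $s_1\le t_1$, $s_2\le t_2$, $$\langle\mathbf S_{\mathbf s\mathbf t}(\tau X),(w,\nu)\rangle=\langle\mathbf S_{\mathbf s\mathbf t}(X),(w,\nu)\rangle.$$
   Context: Full 2D signature: with $\partial_{12}X=\frac{\partial^2X}{\partial r_1\partial r_2}$, $$\langle \mathbf S_{\mathbf s\mathbf t}(X),(w,\nu)\rangle=\int_{\Delta^n_{[\mathbf s,\mathbf t]}}\prod_{i=1}^n\partial_{12}X^{w_i}(r_1^i,r_2^{\nu(i)})\,d\mathbf r^1\cdots d\mathbf r^n,$$ where $\mathbf r^i=(r_1^i,r_2^i)$ and $\Delta^n_{[\mathbf s,\mathbf t]}=\{(\mathbf r^1,\dots,\mathbf r^n): s_1\le r_1^1\le\dots\le r_1^n\le t_1,\ s_2\le r_2^1\le\dots\le r_2^n\le t_2\}$ (value $1$ for the empty word). *)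

theory Defs
  imports "HOL-Analysis.Analysis" "HOL-Combinatorics.Permutations"
begin

text \<open>Derivatives are taken within \<open>S\<close>, hence one-sided at boundary points. They are unique on
  the sets used here, \<open>[0,T]\<close> and \<open>[0,T]\<^sup>2\<close> with \<open>T > 0\<close>. Continuity of \<open>f\<close> and \<open>f'\<close> follows
  from their differentiability.\<close>

definition C2_on :: "'a::real_normed_vector set \<Rightarrow> ('a \<Rightarrow> 'b::real_normed_vector) \<Rightarrow> bool" where
  "C2_on S f \<longleftrightarrow> (\<exists>(f' :: 'a \<Rightarrow> 'a \<Rightarrow>\<^sub>L 'b) (f'' :: 'a \<Rightarrow> 'a \<Rightarrow>\<^sub>L ('a \<Rightarrow>\<^sub>L 'b)).
     (\<forall>x\<in>S. (f has_derivative blinfun_apply (f' x)) (at x within S)) \<and>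
     (\<forall>x\<in>S. (f' has_derivative blinfun_apply (f'' x)) (at x within S)) \<and>
     continuous_on S f'')"

definition partial1 :: "real \<Rightarrow> (real \<times> real \<Rightarrow> 'b::real_normed_vector) \<Rightarrow> real \<times> real \<Rightarrow> 'b" where
  "partial1 T f = (\<lambda>(r1, r2). vector_derivative (\<lambda>u. f (u, r2)) (at r1 within {0..T}))"

definition partial2 :: "real \<Rightarrow> (real \<times> real \<Rightarrow> 'b::real_normed_vector) \<Rightarrow> real \<times> real \<Rightarrow> 'b" where
  "partial2 T f = (\<lambda>(r1, r2). vector_derivative (\<lambda>u. f (r1, u)) (at r2 within {0..T}))"

definition partial12 :: "real \<Rightarrow> (real \<times> real \<Rightarrow> 'b::real_normed_vector) \<Rightarrow> real \<times> real \<Rightarrow> 'b" where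
  "partial12 T f = partial1 T (partial2 T f)"

text \<open>Points of \<open>(\<real>\<^sup>2)\<^sup>n\<close> are extensional functions on the index set \<open>{..<n}\<close>; all indices
  are shifted to start at \<open>0\<close>.\<close>

definition simplex2D :: "nat \<Rightarrow> real \<times> real \<Rightarrow> real \<times> real \<Rightarrow> (nat \<Rightarrow> real \<times> real) set" where
  "simplex2D n s t = {r \<in> {..<n} \<rightarrow>\<^sub>E UNIV.
     (\<forall>i<n. fst s \<le> fst (r i) \<and> fst (r i) \<le> fst t) \<and> mono_on {..<n} (\<lambda>i. fst (r i)) \<and>
     (\<forall>i<n. snd s \<le> snd (r i) \<and> snd (r i) \<le> snd t) \<and> mono_on {..<n} (\<lambda>i. snd (r i))}"

definition signature2D ::
  "real \<Rightarrow> (real \<times> real \<Rightarrow> real ^ 'd) \<Rightarrow> real \<times> real \<Rightarrow> real \<times> real \<Rightarrow> 'd list \<Rightarrow> (nat \<Rightarrow> nat) \<Rightarrow> real"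
where
  "signature2D T X s t w \<nu> =
     (LINT r : simplex2D (length w) s t | (\<Pi>\<^sub>M i\<in>{..<length w}. lborel).
        (\<Prod>i<length w. partial12 T (\<lambda>p. X p $ (w ! i)) (fst (r i), snd (r (\<nu> i)))))"

lemma signature2D_Nil: "signature2D T X s t [] \<nu> = 1"
  by (simp add: signature2D_def simplex2D_def set_lebesgue_integral_def PiM_empty
      lebesgue_integral_count_space_finite mono_on_def)

definition translate2D ::
  "(real \<times> real \<Rightarrow> real ^ 'd) \<Rightarrow> (real \<Rightarrow> real ^ 'd) \<Rightarrow> (real \<Rightarrow> real ^ 'd) \<Rightarrow> real ^ 'd
    \<Rightarrow> real \<times> real \<Rightarrow> real ^ 'd"
where
  "translate2D X x1 x2 a = (\<lambda>(t1, t2). X (t1, t2) + x1 t1 + x2 t2 + a)"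

end

theory Submission
  imports Defs
begin

text \<open>On the square, the second partial derivative of the translated field differs from that of
  \<open>X\<close> only by a term that does not depend on the first variable, so that the mixed partial
  derivatives, and hence the integrands on the simplex, coincide.\<close>

lemma C2_on_imp_differentiable:
  assumes "C2_on S f" "x \<in> S"
  shows "f differentiable (at x within S)"
  using assms unfolding C2_on_def differentiable_def by blast

text \<open>Chain rule along the segment \<open>Pair x\<close>: as \<open>x \<in> A\<close>, the
  image of \<open>B\<close> stays inside \<open>A \<times> B\<close>, so differentiability within
  the product restricts to it.\<close>

lemma differentiable_Pair2_slice:
  fixes f :: "'a::real_normed_vector \<times> 'b::real_normed_vector \<Rightarrow> 'c::real_normed_vector"
  assumes "f differentiable (at (x, y) within A \<times> B)" "x \<in> A"
  shows "(\<lambda>u. f (x, u)) differentiable (at y within B)"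
proof -
  have "f differentiable (at (x, y) within Pair x ` B)"
    by (rule differentiable_within_subset[OF assms(1)]) (use assms(2) in auto)
  moreover have "Pair x differentiable (at y within B)"
    using has_derivative_Pair[OF has_derivative_const has_derivative_ident]
    unfolding differentiable_def by blast
  ultimately show ?thesis
    using differentiable_chain_within[of "Pair x" y B f] by (simp add: o_def)
qed

lemma differentiable_vec_nth:
  fixes f :: "'a::real_normed_vector \<Rightarrow> real ^ 'n"
  assumes "f differentiable F"
  shows "(\<lambda>x. f x $ i) differentiable F"
  using assms bounded_linear.has_derivative[OF bounded_linear_vec_nth]
  unfolding differentiable_def by blast

text \<open>Adding a constant leaves the set of admissible derivatives unchanged, so the choice
  operator behind \<open>vector_derivative\<close> returns the same value even where no derivative
  exists. Applied to second partials, this spares any proof that they are differentiable in the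
  first variable.\<close>

lemma vector_derivative_eq_of_diff_const:
  assumes "x \<in> S" "\<And>u. u \<in> S \<Longrightarrow> g u = f u + c"
  shows "vector_derivative g (at x within S) = vector_derivative f (at x within S)"
proof -
  have "(g has_vector_derivative D) (at x within S) \<longleftrightarrow> (f has_vector_derivative D) (at x within S)"
    for D
  proof
    assume "(g has_vector_derivative D) (at x within S)"
    from has_vector_derivative_diff[OF this has_vector_derivative_const[of c]]
    have "((\<lambda>u. g u - c) has_vector_derivative D) (at x within S)" by simp
    then show "(f has_vector_derivative D) (at x within S)"
      by (rule has_vector_derivative_transform[OF assms(1), rotated]) (simp add: assms(2))
  next
    assume "(f has_vector_derivative D) (at x within S)"
    from has_vector_derivative_add[OF this has_vector_derivative_const[of c]]
    have "((\<lambda>u. f u + c) has_vector_derivative D) (at x within S)" by simp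
    then show "(g has_vector_derivative D) (at x within S)"
      by (rule has_vector_derivative_transform[OF assms(1), rotated]) (simp add: assms(2))
  qed
  then show ?thesis unfolding vector_derivative_def by simp
qed

text \<open>In the second variable, \<open>x1 r1\<close> and \<open>a\<close> are constants and drop
  out. What remains of the translation depends on \<open>r2\<close> alone, which makes it a constant
  for the next differentiation.\<close>

lemma partial2_translate2D:
  assumes "T > 0" "C2_on ({0..T} \<times> {0..T}) X" "C2_on {0..T} x2" "r1 \<in> {0..T}" "r2 \<in> {0..T}"
  shows "partial2 T (\<lambda>p. translate2D X x1 x2 a p $ i) (r1, r2) =
    partial2 T (\<lambda>p. X p $ i) (r1, r2) + vector_derivative (\<lambda>u. x2 u $ i) (at r2 within {0..T})"
proof -
  have "X differentiable (at (r1, r2) within {0..T} \<times> {0..T})"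
    using assms by (intro C2_on_imp_differentiable) auto
  then have "(\<lambda>u. X (r1, u) $ i) differentiable (at r2 within {0..T})"
    using differentiable_Pair2_slice assms(4) by (intro differentiable_vec_nth) blast
  moreover have "(\<lambda>u. x2 u $ i) differentiable (at r2 within {0..T})"
    using assms by (intro differentiable_vec_nth C2_on_imp_differentiable)
  ultimately have
    "((\<lambda>u. X (r1, u) $ i + x2 u $ i + (x1 r1 $ i + a $ i)) has_vector_derivative
      vector_derivative (\<lambda>u. X (r1, u) $ i) (at r2 within {0..T}) +
      vector_derivative (\<lambda>u. x2 u $ i) (at r2 within {0..T}) + 0) (at r2 within {0..T})"
    by (intro has_vector_derivative_add has_vector_derivative_const)
      (simp_all add: vector_derivative_works)
  then have
    "vector_derivative (\<lambda>u. X (r1, u) $ i + x2 u $ i + (x1 r1 $ i + a $ i)) (at r2 within {0..T}) =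
      vector_derivative (\<lambda>u. X (r1, u) $ i) (at r2 within {0..T}) +
      vector_derivative (\<lambda>u. x2 u $ i) (at r2 within {0..T})"
    \<comment> \<open>\<open>T > 0\<close> makes the interval nondegenerate, so derivatives within
      it are unique, also at the endpoints.\<close>
    using vector_derivative_within_closed_interval[OF assms(1,5)] by simp
  then show ?thesis by (simp add: partial2_def translate2D_def algebra_simps)
qed

lemma partial12_translate2D:
  assumes "T > 0" "C2_on ({0..T} \<times> {0..T}) X" "C2_on {0..T} x2" "r1 \<in> {0..T}" "r2 \<in> {0..T}"
  shows "partial12 T (\<lambda>p. translate2D X x1 x2 a p $ i) (r1, r2) = partial12 T (\<lambda>p. X p $ i) (r1, r2)"
  unfolding partial12_def partial1_def prod.case
  \<comment> \<open>The constant \<open>c\<close> is the derivative of the \<open>i\<close>-th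
    component of \<open>x2\<close> at \<open>r2\<close>; the difference has to be constant on all of
    \<open>{0..T}\<close>, not only at \<open>r1\<close>.\<close>
  by (rule vector_derivative_eq_of_diff_const[OF assms(4)])
    (rule partial2_translate2D[OF assms(1-3) _ assms(5)])

theorem mainTheorem10:
  fixes T :: real
    and X :: "real \<times> real \<Rightarrow> real ^ 'd"
    and a :: "real ^ 'd"
    and x1 x2 :: "real \<Rightarrow> real ^ 'd"
    and w :: "'d list"
    and \<nu> :: "nat \<Rightarrow> nat"
    and s t :: "real \<times> real"
  assumes "T > 0"
    and "C2_on ({0..T} \<times> {0..T}) X"
    and "C2_on {0..T} x1"
    and "C2_on {0..T} x2"
    and "\<nu> permutes {..<length w}"
    and "s \<in> {0..T} \<times> {0..T}"
    and "t \<in> {0..T} \<times> {0..T}"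
    and "fst s \<le> fst t"
    and "snd s \<le> snd t"
  shows "signature2D T (translate2D X x1 x2 a) s t w \<nu> = signature2D T X s t w \<nu>"
proof -
  have "(\<Prod>i<length w. partial12 T (\<lambda>p. translate2D X x1 x2 a p $ (w ! i)) (fst (r i), snd (r (\<nu> i))))
      = (\<Prod>i<length w. partial12 T (\<lambda>p. X p $ (w ! i)) (fst (r i), snd (r (\<nu> i))))"
    if r: "r \<in> simplex2D (length w) s t" for r
  proof (intro prod.cong refl partial12_translate2D assms(1,2,4))
    fix i assume i: "i \<in> {..<length w}"
    \<comment> \<open>The simplex bounds \<open>r\<close> only at indices below
      \<open>length w\<close>, so \<open>\<nu> i\<close> must stay in that range for the second
      coordinate to lie in \<open>{0..T}\<close>.\<close>
    then have "\<nu> i < length w" using permutes_in_image[OF assms(5)] by blast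
    with i r have "fst s \<le> fst (r i)" "fst (r i) \<le> fst t"
      "snd s \<le> snd (r (\<nu> i))" "snd (r (\<nu> i)) \<le> snd t"
      by (auto simp: simplex2D_def)
    with assms(6,7) show "fst (r i) \<in> {0..T}" "snd (r (\<nu> i)) \<in> {0..T}" by auto
  qed
  then show ?thesis
    unfolding signature2D_def set_lebesgue_integral_def
    \<comment> \<open>Off the simplex the indicator makes both integrands zero, so they agree at
      every point and the integrals coincide, integrable or not.\<close>
    by (intro Bochner_Integration.integral_cong refl) (auto simp: indicator_def)
qed

end
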